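(* Let $\mathbf{d}$ and $\mathbf{e}$ be distances on a set $X$. The following are equivalent. (1) $X$ is $\mathbf{e}$-$\sup$-complete, $X$ is $\mathbf{d}$-$\mathbf{e}$-$\sup$-continuous, and $\mathbf{d}=\sup\mathbf{e}$. (2) $X$ is $\mathbf{d}$-$\max$-complete, $X$ is $\mathbf{d}$-$\max$-continuous, and $\mathbf{e}=\underline{\mathbf{d}}\geq\overline{\mathbf{d}}$.
   Context: Suprema and infima are taken in $[0,\infty]$, with $\sup\emptyset=0$, $\inf\emptyset=\infty$; for $a,b\in[0,\infty]$, $(a-b)_+=\min\{c\in[0,\infty]:a\leq b+c\}$. A distance on $X$ is a function $\mathbf{d}:X\times X\to[0,\infty]$, written $x\mathbf{d}y$, with $x\mathbf{d}z\leq x\mathbf{d}y+y\mathbf{d}z$ for all $x,y,z$ (no symmetry, and $x\mathbf{d}x=0$ is not required). Functions are ordered pointwise. The upper and lower hemimetrics are $x\overline{\mathbf{d}}z=\sup_{y\in X}(x\mathbf{d}y-z\mathbf{d}y)_+$ and $z\underline{\mathbf{d}}y=\sup_{x\in X}(x\mathbf{d}y-x\mathbf{d}z)_+$. $Y\subseteq X$ is $\mathbf{d}$-directed if $\inf_{y\in Y}\sup_{z\in F}z\mathbf{d}y=0$ for every finite $F\subseteq Y$ (so $Y\neq\emptyset$); similarly $\mathbf{e}$-directed. $x$ is a $\mathbf{d}$-maximum of $Y$ ($x=\mathbf{d}$-$\max Y$) if $y\mathbf{d}x=0$ for all $y\in Y$ and $\inf_{y\in Y}z\mathbf{d}y\leq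 z\mathbf{d}x$ for all $z\in X$. $x$ is an $\mathbf{e}$-supremum of $Y$ ($x=\mathbf{e}$-$\sup Y$) if $y\mathbf{e}x=0$ for all $y\in Y$ and $x\mathbf{e}z\leq\sup_{y\in Y}y\mathbf{e}z$ for all $z\in X$. $X$ is $\mathbf{d}$-$\max$-complete if every $\mathbf{d}$-directed subset of $X$ has a $\mathbf{d}$-maximum in $X$; $\mathbf{e}$-$\sup$-complete if every $\mathbf{e}$-directed subset of $X$ has an $\mathbf{e}$-supremum in $X$; $\mathbf{d}$-$\max$-continuous if every $x\in X$ is a $\mathbf{d}$-maximum of some $\mathbf{d}$-directed subset of $X$; $\mathbf{d}$-$\mathbf{e}$-$\sup$-continuous if every $x\in X$ is an $\mathbf{e}$-supremum of some $\mathbf{d}$-directed subset of $X$. The way-below distance $\sup\mathbf{e}$ is the function on $X\times X$ defined by $x(\sup\mathbf{e})y=\sup\{(\inf_{w\in Z}x\mathbf{e}w-y\mathbf{e}z)_+:Z\subseteq X\text{ is }\mathbf{e}\text{-directed},\ z\in X,\ z=\mathbf{e}\text{-}\sup Z\}$. *)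

theory Defs
  imports "HOL-Library.Extended_Nonnegative_Real"
begin

(* Distances are curried functions into ennreal, relativised to a carrier set X.
   In ennreal the supremum of the empty set is 0 and its infimum is top. *)

(* The library subtraction on ennreal is not used because top - top = top there,
   whereas the positive part of infinity minus infinity is 0 here.
   The lemma pos_diff_least shows that the infimum is a minimum. *)
definition pos_diff :: "ennreal \<Rightarrow> ennreal \<Rightarrow> ennreal" where
  "pos_diff a b = Inf {c. a \<le> b + c}"

lemma pos_diff_least:
  "a \<le> b + pos_diff a b" "a \<le> b + c \<Longrightarrow> pos_diff a b \<le> c"
proof -
  show "pos_diff a b \<le> c" if "a \<le> b + c"
    using that unfolding pos_diff_def by (auto intro: Inf_lower)
  show "a \<le> b + pos_diff a b"
  proof (cases "b = top")
    case False
    have "a - b \<le> c" if "a \<le> b + c" for c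
      using that by (simp add: ennreal_minus_le_iff False)
    then have "a - b \<le> pos_diff a b"
      unfolding pos_diff_def by (auto intro: Inf_greatest)
    then show ?thesis
      by (simp add: ennreal_minus_le_iff False)
  qed simp
qed

definition distance_on :: "'a set \<Rightarrow> ('a \<Rightarrow> 'a \<Rightarrow> ennreal) \<Rightarrow> bool" where
  "distance_on X d \<longleftrightarrow> (\<forall>x\<in>X. \<forall>y\<in>X. \<forall>z\<in>X. d x z \<le> d x y + d y z)"

definition upper_hemi :: "'a set \<Rightarrow> ('a \<Rightarrow> 'a \<Rightarrow> ennreal) \<Rightarrow> 'a \<Rightarrow> 'a \<Rightarrow> ennreal" where
  "upper_hemi X d x z = (SUP y\<in>X. pos_diff (d x y) (d z y))"

definition lower_hemi :: "'a set \<Rightarrow> ('a \<Rightarrow> 'a \<Rightarrow> ennreal) \<Rightarrow> 'a \<Rightarrow> 'a \<Rightarrow> ennreal" where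
  "lower_hemi X d z y = (SUP x\<in>X. pos_diff (d x y) (d x z))"

definition directed :: "'a set \<Rightarrow> ('a \<Rightarrow> 'a \<Rightarrow> ennreal) \<Rightarrow> 'a set \<Rightarrow> bool" where
  "directed X d Y \<longleftrightarrow>
     Y \<subseteq> X \<and> (\<forall>F. finite F \<and> F \<subseteq> Y \<longrightarrow> (INF y\<in>Y. SUP z\<in>F. d z y) = 0)"

definition is_max :: "'a set \<Rightarrow> ('a \<Rightarrow> 'a \<Rightarrow> ennreal) \<Rightarrow> 'a set \<Rightarrow> 'a \<Rightarrow> bool" where
  "is_max X d Y x \<longleftrightarrow>
     x \<in> X \<and> (\<forall>y\<in>Y. d y x = 0) \<and> (\<forall>z\<in>X. (INF y\<in>Y. d z y) \<le> d z x)"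

definition is_sup :: "'a set \<Rightarrow> ('a \<Rightarrow> 'a \<Rightarrow> ennreal) \<Rightarrow> 'a set \<Rightarrow> 'a \<Rightarrow> bool" where
  "is_sup X e Y x \<longleftrightarrow>
     x \<in> X \<and> (\<forall>y\<in>Y. e y x = 0) \<and> (\<forall>z\<in>X. e x z \<le> (SUP y\<in>Y. e y z))"

definition max_complete :: "'a set \<Rightarrow> ('a \<Rightarrow> 'a \<Rightarrow> ennreal) \<Rightarrow> bool" where
  "max_complete X d \<longleftrightarrow> (\<forall>Y. directed X d Y \<longrightarrow> (\<exists>x. is_max X d Y x))"

definition sup_complete :: "'a set \<Rightarrow> ('a \<Rightarrow> 'a \<Rightarrow> ennreal) \<Rightarrow> bool" where
  "sup_complete X e \<longleftrightarrow> (\<forall>Y. directed X e Y \<longrightarrow> (\<exists>x. is_sup X e Y x))"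

definition max_continuous :: "'a set \<Rightarrow> ('a \<Rightarrow> 'a \<Rightarrow> ennreal) \<Rightarrow> bool" where
  "max_continuous X d \<longleftrightarrow> (\<forall>x\<in>X. \<exists>Y. directed X d Y \<and> is_max X d Y x)"

definition d_e_sup_continuous ::
  "'a set \<Rightarrow> ('a \<Rightarrow> 'a \<Rightarrow> ennreal) \<Rightarrow> ('a \<Rightarrow> 'a \<Rightarrow> ennreal) \<Rightarrow> bool" where
  "d_e_sup_continuous X d e \<longleftrightarrow> (\<forall>x\<in>X. \<exists>Y. directed X d Y \<and> is_sup X e Y x)"

definition way_below :: "'a set \<Rightarrow> ('a \<Rightarrow> 'a \<Rightarrow> ennreal) \<Rightarrow> 'a \<Rightarrow> 'a \<Rightarrow> ennreal" where
  "way_below X e x y =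
     Sup {pos_diff (INF w\<in>Z. e x w) (e y z) | Z z. directed X e Z \<and> is_sup X e Z z}"

end

theory Submission
  imports Defs
begin

text \<open>
  Both sides of the equivalence make \<open>e\<close> act on \<open>d\<close> from the right and from the left,
  \<open>d x z \<le> d x y + e y z\<close> and \<open>d x z \<le> e x y + d y z\<close>, and both give \<open>e \<le> d\<close> and
  \<open>e x x = 0\<close>. When \<open>e\<close> is the lower hemimetric, the right action is the definition of
  \<open>e\<close>, the left action says that \<open>e\<close> dominates the upper hemimetric, and \<open>e \<le> d\<close> is the
  triangle inequality for \<open>d\<close>. When \<open>d\<close> is the way-below distance, the two actions come
  from the triangle inequality for \<open>e\<close>, and \<open>e \<le> d\<close> from testing \<open>d\<close> on singletons.

  Given these inequalities, what remains is that on \<open>d\<close>-directed sets \<open>e\<close>-suprema and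
  \<open>d\<close>-maxima are the same thing, and that \<open>e\<close>-directed sets can be traded for
  \<open>d\<close>-directed ones. Both rest on one construction: replace every point \<open>y\<close> of a directed
  set \<open>Y\<close> by a directed set \<open>D y\<close> approximating it, and take the union. The union is again
  directed (\<open>directed_UNION\<close>) and has the same \<open>e\<close>-suprema as \<open>Y\<close>
  (\<open>is_sup_UNION_iff\<close>).

  From maxima to suprema, an \<open>e\<close>-directed \<open>Y\<close> is refined in this way to a \<open>d\<close>-directed
  set, whose \<open>d\<close>-maximum is an \<open>e\<close>-supremum of \<open>Y\<close>; the same refinement bounds the
  way-below distance by \<open>d\<close>. From suprema to maxima, the union is used as an interpolation:
  the definition of the way-below distance yields only \<open>(INF y\<in>Y. e z y) \<le> d z x\<close> for a
  supremum \<open>x\<close> of \<open>Y\<close>, but applied to the union it yields the bound with \<open>d\<close> in place of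
  \<open>e\<close> that a maximum demands, because \<open>d z y \<le> e z v + d v y = e z v\<close> for \<open>v \<in> D y\<close>.
\<close>

section \<open>Inequalities that characterise the derived distances\<close>

text \<open>
  The positive part of a difference is left adjoint to addition. This also covers infinite
  values, so that subtraction disappears from all later arguments.
\<close>

lemma pos_diff_le_iff: "pos_diff a b \<le> c \<longleftrightarrow> a \<le> b + c"
proof
  assume "pos_diff a b \<le> c"
  then have "b + pos_diff a b \<le> b + c" by (rule add_left_mono)
  with pos_diff_least(1)[of a b] show "a \<le> b + c" by (rule order_trans)
qed (rule pos_diff_least(2))

text \<open>
  By the adjunction, adding a constant commutes with infima as far as needed.
\<close>

lemma le_INF_add:
  fixes f :: "'b \<Rightarrow> ennreal"
  assumes "\<And>y. y \<in> Y \<Longrightarrow> a \<le> c + f y"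
  shows "a \<le> c + (INF y\<in>Y. f y)"
  unfolding pos_diff_le_iff[symmetric]
  by (intro INF_greatest) (simp add: pos_diff_le_iff assms)

lemma lower_hemi_le_iff:
  "lower_hemi X d z y \<le> c \<longleftrightarrow> (\<forall>x\<in>X. d x y \<le> d x z + c)"
  by (simp add: lower_hemi_def SUP_le_iff pos_diff_le_iff)

lemma upper_hemi_le_iff:
  "upper_hemi X d x z \<le> c \<longleftrightarrow> (\<forall>y\<in>X. d x y \<le> d z y + c)"
  by (simp add: upper_hemi_def SUP_le_iff pos_diff_le_iff)

lemma way_below_le_iff:
  "way_below X e x y \<le> c \<longleftrightarrow>
     (\<forall>Z z. directed X e Z \<longrightarrow> is_sup X e Z z \<longrightarrow> (INF w\<in>Z. e x w) \<le> e y z + c)"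
  unfolding way_below_def Sup_le_iff pos_diff_le_iff[symmetric] by blast

section \<open>Directed sets\<close>

lemma INF_eq_0_iff:
  fixes f :: "'b \<Rightarrow> ennreal"
  shows "(INF y\<in>Y. f y) = 0 \<longleftrightarrow> (\<forall>r>0. \<exists>y\<in>Y. f y \<le> r)"
proof
  assume "(INF y\<in>Y. f y) = 0"
  then show "\<forall>r>0. \<exists>y\<in>Y. f y \<le> r"
    by (metis INF_less_iff less_imp_le)
next
  assume r: "\<forall>r>0. \<exists>y\<in>Y. f y \<le> r"
  show "(INF y\<in>Y. f y) = 0"
  proof (rule ccontr)
    assume "(INF y\<in>Y. f y) \<noteq> 0"
    then obtain r where "0 < r" "r < (INF y\<in>Y. f y)"
      by (metis dense zero_less_iff_neq_zero)
    with r show False by (metis INF_lower leD order_trans)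
  qed
qed

lemma directed_iff_finite:
  "directed X d Y \<longleftrightarrow>
     Y \<subseteq> X \<and> (\<forall>F. finite F \<and> F \<subseteq> Y \<longrightarrow> (\<forall>r>0. \<exists>y\<in>Y. \<forall>z\<in>F. d z y \<le> r))"
  by (simp add: directed_def INF_eq_0_iff SUP_le_iff)

lemma ennreal_halves: "r / 2 + r / 2 = (r::ennreal)" "0 < r \<Longrightarrow> 0 < r / (2::ennreal)"
proof -
  have "r / 2 + r / 2 = r * 2 / (2::ennreal)"
    by (simp add: add_divide_distrib_ennreal mult_2_right)
  then show "r / 2 + r / 2 = r" by (simp add: mult_divide_eq_ennreal)
qed (simp add: ennreal_zero_less_divide)

lemma distance_onD:
  "distance_on X d \<Longrightarrow> x \<in> X \<Longrightarrow> y \<in> X \<Longrightarrow> z \<in> X \<Longrightarrow> d x z \<le> d x y + d y z"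
  by (auto simp: distance_on_def)

lemma distance_on_le_halves:
  assumes "distance_on X d" "x \<in> X" "y \<in> X" "z \<in> X" "d x y \<le> r / 2" "d y z \<le> r / 2"
  shows "d x z \<le> r"
  using distance_onD[OF assms(1-4)] add_mono[OF assms(5,6)] by (simp add: ennreal_halves)

text \<open>
  As for directed orders, the empty set and pairs of points suffice: further points are added
  one at a time, and the triangle inequality pays for each with half of the tolerance.
\<close>

lemma directed_iff_pairs:
  assumes d: "distance_on X d"
  shows "directed X d Y \<longleftrightarrow> Y \<subseteq> X \<and> Y \<noteq> {} \<and>
           (\<forall>u\<in>Y. \<forall>v\<in>Y. \<forall>r>0. \<exists>y\<in>Y. d u y \<le> r \<and> d v y \<le> r)"
    (is "_ \<longleftrightarrow> ?P")
proof
  assume dir: "directed X d Y"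
  have "\<exists>y\<in>Y. d u y \<le> r \<and> d v y \<le> r" if "u \<in> Y" "v \<in> Y" "r > 0" for u v r
    using dir[unfolded directed_iff_finite, THEN conjunct2, rule_format, of "{u, v}" r] that
    by auto
  moreover have "Y \<noteq> {}"
    using dir[unfolded directed_iff_finite, THEN conjunct2, rule_format, of "{}" 1] by auto
  ultimately show ?P using dir by (auto simp: directed_def)
next
  assume P: ?P
  have "\<forall>r>0. \<exists>y\<in>Y. \<forall>z\<in>F. d z y \<le> r" if "finite F" "F \<subseteq> Y" for F
    using that
  proof (induction F)
    case empty
    then show ?case using P by auto
  next
    case (insert u F)
    show ?case
    proof (intro allI impI)
      fix r :: ennreal assume "0 < r"
      then have r: "0 < r / 2" by (rule ennreal_halves)
      with insert obtain y where y: "y \<in> Y" "\<forall>z\<in>F. d z y \<le> r / 2" by auto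
      from P r y insert.prems obtain w
        where w: "w \<in> Y" "d u w \<le> r / 2" "d y w \<le> r / 2" by (metis insert_subset)
      have "d z w \<le> r" if "z \<in> F" for z
        using distance_on_le_halves[OF d, of z y w r] that P y w insert.prems by auto
      moreover have "d u w \<le> r"
        using w(2) add_increasing2[of "r / 2" "d u w" "r / 2"] by (simp add: ennreal_halves)
      ultimately show "\<exists>y\<in>Y. \<forall>z\<in>insert u F. d z y \<le> r" using w(1) by auto
    qed
  qed
  with P show "directed X d Y" by (simp add: directed_iff_finite)
qed

lemma directed_nonempty: "directed X d Y \<Longrightarrow> Y \<noteq> {}"
  unfolding directed_def by (metis INF_empty empty_subsetI finite.emptyI top_neq_ennreal ennreal_0)

lemma directed_subset: "directed X d Y \<Longrightarrow> Y \<subseteq> X"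
  by (simp add: directed_def)

text \<open>
  Directedness applied to a single point replaces \<open>d v v = 0\<close>, which may fail.
\<close>

lemma directed_INF_self:
  assumes "directed X d Y" "v \<in> Y"
  shows "(INF y\<in>Y. d v y) = 0"
  using assms(1)[unfolded directed_def, THEN conjunct2, rule_format, of "{v}"] assms(2) by simp

lemma directed_mono:
  assumes "directed X d Y" "\<And>x y. x \<in> X \<Longrightarrow> y \<in> X \<Longrightarrow> e x y \<le> d x y"
  shows "directed X e Y"
  using assms unfolding directed_iff_finite by (meson order_trans subsetD)

text \<open>
  Points \<open>u \<in> D a\<close> and \<open>v \<in> D b\<close> are brought together inside one \<open>D y\<close>, where \<open>y\<close> is
  almost above \<open>a\<close> and \<open>b\<close>: the mixed triangle inequality makes \<open>d u y\<close> and \<open>d v y\<close>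
  small, hence \<open>u\<close> and \<open>v\<close> are \<open>f\<close>-close to members of \<open>D y\<close>, and \<open>D y\<close> is itself
  directed. The third distance \<open>f\<close> is there because the lemma is used with \<open>f = d\<close> for
  families of sets with \<open>d\<close>-maxima and with \<open>f = e\<close> for families of sets with
  \<open>e\<close>-suprema.
\<close>

lemma directed_UNION:
  assumes f: "distance_on X f"
    and Y: "directed X e Y"
    and mix: "\<And>x y z. x \<in> X \<Longrightarrow> y \<in> X \<Longrightarrow> z \<in> X \<Longrightarrow> d x z \<le> d x y + e y z"
    and D: "\<And>y. y \<in> Y \<Longrightarrow> directed X f (D y)"
    and below: "\<And>y v. y \<in> Y \<Longrightarrow> v \<in> D y \<Longrightarrow> d v y = 0"
    and approx: "\<And>y x. y \<in> Y \<Longrightarrow> x \<in> X \<Longrightarrow> (INF w\<in>D y. f x w) \<le> d x y"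
  shows "directed X f (\<Union>y\<in>Y. D y)"
  unfolding directed_iff_pairs[OF f]
proof (intro conjI ballI allI impI)
  note Y_X = directed_subset[OF Y]
  show sub: "(\<Union>y\<in>Y. D y) \<subseteq> X"
    using D directed_subset by blast
  show "(\<Union>y\<in>Y. D y) \<noteq> {}"
    using directed_nonempty[OF Y] directed_nonempty[OF D] by auto
  fix u v and r :: ennreal
  assume "u \<in> (\<Union>y\<in>Y. D y)" "v \<in> (\<Union>y\<in>Y. D y)" and "0 < r"
  then obtain a b where a: "a \<in> Y" "u \<in> D a" and b: "b \<in> Y" "v \<in> D b" by auto
  have uv: "u \<in> X" "v \<in> X" using a b sub by auto
  define s where "s = r / 2"
  have s: "0 < s" "0 < s / 2" using \<open>0 < r\<close> by (simp_all add: s_def ennreal_halves)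
  from Y[unfolded directed_iff_finite, THEN conjunct2, rule_format, of "{a, b}" "s / 2"] a b s
  obtain y where y: "y \<in> Y" "e a y \<le> s / 2" "e b y \<le> s / 2" by auto
  have near: "\<exists>w\<in>D y. f x w \<le> s" if "x \<in> D c" "c \<in> Y" "e c y \<le> s / 2" for x c
  proof (cases "s = top")
    case True
    then show ?thesis using directed_nonempty[OF D[OF y(1)]] by auto
  next
    case False
    have x: "x \<in> X" using that(1,2) sub by auto
    have "(INF w\<in>D y. f x w) \<le> d x y" by (rule approx[OF y(1) x])
    also have "\<dots> \<le> d x c + e c y" using mix[OF x, of c y] that(2) y(1) Y_X by blast
    also have "\<dots> \<le> s / 2" using below[OF that(2,1)] that(3) by simp
    \<comment> \<open>Strictness is needed because the infimum over \<open>D y\<close> need not be attained.\<close>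
    also have "\<dots> < s"
      using s False by (cases s) (auto simp: ennreal_divide_numeral ennreal_less_iff)
    finally show ?thesis by (auto simp: INF_less_iff intro: less_imp_le)
  qed
  obtain p q where p: "p \<in> D y" "f u p \<le> s" and q: "q \<in> D y" "f v q \<le> s"
    using near[OF a(2,1) y(2)] near[OF b(2,1) y(3)] by blast
  from D[OF y(1), unfolded directed_iff_pairs[OF f]] p(1) q(1) s(1) obtain w
    where w: "w \<in> D y" "f p w \<le> s" "f q w \<le> s" by meson
  have pqw: "p \<in> X" "q \<in> X" "w \<in> X" using p q w y(1) sub by auto
  have "f u w \<le> r" "f v w \<le> r"
    using distance_on_le_halves[OF f, of u p w r] distance_on_le_halves[OF f, of v q w r]
      uv pqw p(2) q(2) w(2,3) by (auto simp: s_def)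
  with w(1) y(1) show "\<exists>w\<in>(\<Union>y\<in>Y. D y). f u w \<le> r \<and> f v w \<le> r" by blast
qed

text \<open>
  An \<open>e\<close>-supremum of \<open>Y\<close> is determined by the function \<open>z \<mapsto> (SUP y\<in>Y. e y z)\<close>, since a
  point is an upper bound exactly when this function vanishes at it. Each \<open>e y z\<close> equals the supremum
  over \<open>D y\<close>, so the union has the same function.
\<close>

lemma is_sup_UNION_iff:
  assumes e: "distance_on X e"
    and Y: "Y \<subseteq> X" and D: "\<And>y. y \<in> Y \<Longrightarrow> D y \<subseteq> X"
    and sup: "\<And>y. y \<in> Y \<Longrightarrow> is_sup X e (D y) y"
  shows "is_sup X e (\<Union>y\<in>Y. D y) x \<longleftrightarrow> is_sup X e Y x"
proof -
  have below: "e v z \<le> e y z" if "y \<in> Y" "v \<in> D y" "z \<in> X" for y v z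
    using distance_onD[OF e, of v y z] sup[OF that(1)] D[OF that(1)] Y that
    by (auto simp: is_sup_def)
  have above: "e y z \<le> (SUP v\<in>D y. e v z)" if "y \<in> Y" "z \<in> X" for y z
    using sup[OF that(1)] that(2) by (auto simp: is_sup_def)
  have SUP_eq: "(SUP v\<in>(\<Union>y\<in>Y. D y). e v z) = (SUP y\<in>Y. e y z)" if z: "z \<in> X" for z
  proof (rule antisym)
    show "(SUP v\<in>(\<Union>y\<in>Y. D y). e v z) \<le> (SUP y\<in>Y. e y z)"
      using below z by (fastforce intro!: SUP_least intro: SUP_upper2)
    show "(SUP y\<in>Y. e y z) \<le> (SUP v\<in>(\<Union>y\<in>Y. D y). e v z)"
    proof (rule SUP_least)
      fix y assume y: "y \<in> Y"
      note above[OF y z]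
      also have "(SUP v\<in>D y. e v z) \<le> (SUP v\<in>(\<Union>y\<in>Y. D y). e v z)"
        using y by (intro SUP_subset_mono) auto
      finally show "e y z \<le> (SUP v\<in>(\<Union>y\<in>Y. D y). e v z)" .
    qed
  qed
  have "(\<forall>v\<in>(\<Union>y\<in>Y. D y). e v x = 0) \<longleftrightarrow> (\<forall>y\<in>Y. e y x = 0)" if "x \<in> X"
    using SUP_eq[OF that] SUP_bot_conv(1)[of "\<lambda>v. e v x" "\<Union>y\<in>Y. D y"]
      SUP_bot_conv(1)[of "\<lambda>v. e v x" Y] by (simp only: bot_ennreal)
  with SUP_eq show ?thesis unfolding is_sup_def by auto
qed

section \<open>From maxima to suprema\<close>

locale lower_hemimetric_distance =
  fixes X :: "'a set" and d e :: "'a \<Rightarrow> 'a \<Rightarrow> ennreal"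
  assumes d: "distance_on X d" and e: "distance_on X e"
    and e_eq: "\<And>x y. x \<in> X \<Longrightarrow> y \<in> X \<Longrightarrow> e x y = lower_hemi X d x y"
    and upper_le: "\<And>x y. x \<in> X \<Longrightarrow> y \<in> X \<Longrightarrow> upper_hemi X d x y \<le> lower_hemi X d x y"
    and max_complete: "max_complete X d"
    and max_continuous: "max_continuous X d"
begin

lemma e_le_iff: "y \<in> X \<Longrightarrow> z \<in> X \<Longrightarrow> e y z \<le> c \<longleftrightarrow> (\<forall>x\<in>X. d x z \<le> d x y + c)"
  by (simp add: e_eq lower_hemi_le_iff)

lemma d_e: "x \<in> X \<Longrightarrow> y \<in> X \<Longrightarrow> z \<in> X \<Longrightarrow> d x z \<le> d x y + e y z"
  using e_le_iff[of y z "e y z"] by auto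

lemma e_d: "x \<in> X \<Longrightarrow> y \<in> X \<Longrightarrow> z \<in> X \<Longrightarrow> d x z \<le> e x y + d y z"
  using upper_le[of x y] upper_hemi_le_iff[of X d x y "e x y"] by (simp add: e_eq add.commute)

lemma e_le_d: "x \<in> X \<Longrightarrow> y \<in> X \<Longrightarrow> e x y \<le> d x y"
  using distance_onD[OF d] by (simp add: e_le_iff)

lemma e_self: "x \<in> X \<Longrightarrow> e x x = 0"
  using e_le_iff[of x x 0] by simp

text \<open>
  Testing against \<open>w\<close>, the bound \<open>d w z \<le> d w y + e y z\<close> holds for every \<open>y \<in> Y\<close>. Taking
  the infimum over \<open>y\<close> turns \<open>d w y\<close> into \<open>d w x\<close>.
\<close>

lemma max_imp_sup:
  assumes Y: "Y \<subseteq> X" and max: "is_max X d Y x"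
  shows "is_sup X e Y x"
  unfolding is_sup_def
proof (intro conjI ballI)
  show x: "x \<in> X" using max by (simp add: is_max_def)
  show "e y x = 0" if "y \<in> Y" for y
    using e_le_d[of y x] max that x Y by (auto simp: is_max_def)
  fix z assume z: "z \<in> X"
  let ?S = "SUP y\<in>Y. e y z"
  have "d w z \<le> d w x + ?S" if w: "w \<in> X" for w
  proof -
    have "d w z \<le> ?S + (INF y\<in>Y. d w y)"
    proof (rule le_INF_add)
      fix y assume y: "y \<in> Y"
      have "d w z \<le> e y z + d w y" using d_e[of w y z] y w z Y by (auto simp: add.commute)
      also have "\<dots> \<le> ?S + d w y" using y by (intro add_right_mono SUP_upper)
      finally show "d w z \<le> ?S + d w y" .
    qed
    also have "\<dots> \<le> ?S + d w x" using max w by (intro add_left_mono) (auto simp: is_max_def)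
    finally show ?thesis by (simp add: add.commute)
  qed
  then show "e x z \<le> ?S" using x z by (simp add: e_le_iff)
qed

text \<open>
  The set has a maximum by completeness, and this maximum is also a supremum. Two suprema are
  at \<open>e\<close>-distance zero in both directions, and \<open>d\<close> cannot tell such points apart in its
  second argument.
\<close>

lemma sup_imp_max:
  assumes Y: "directed X d Y" and sup: "is_sup X e Y z"
  shows "is_max X d Y z"
proof -
  from max_complete Y obtain x where max: "is_max X d Y x" by (auto simp: max_complete_def)
  have Y_X: "Y \<subseteq> X" by (rule directed_subset[OF Y])
  have sup': "is_sup X e Y x" by (rule max_imp_sup[OF Y_X max])
  have xz: "x \<in> X" "z \<in> X" using sup sup' by (auto simp: is_sup_def)
  have least: "e a b = 0" if "is_sup X e Y a" "is_sup X e Y b" for a b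
  proof -
    have "e a b \<le> (SUP y\<in>Y. e y b)" using that by (auto simp: is_sup_def)
    also have "\<dots> \<le> 0" using that(2) by (intro SUP_least) (simp add: is_sup_def)
    finally show ?thesis by simp
  qed
  have "d w x = d w z" if "w \<in> X" for w
    using d_e[of w x z] d_e[of w z x] that xz least[OF sup sup'] least[OF sup' sup]
    by (auto intro: antisym)
  with max xz Y_X show ?thesis by (simp add: is_max_def subset_iff)
qed

text \<open>
  The trade of an \<open>e\<close>-directed set for a \<open>d\<close>-directed one. It carries both completeness with
  respect to \<open>e\<close> and the upper bound for the way-below distance.
\<close>

lemma directed_refinement:
  assumes Y: "directed X e Y"
  shows "\<exists>Z. directed X d Z \<and> (\<forall>v\<in>Z. \<exists>y\<in>Y. d v y = 0) \<and>
           (\<forall>x. is_sup X e Z x \<longleftrightarrow> is_sup X e Y x)"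
proof -
  note Y_X = directed_subset[OF Y]
  have "\<forall>y\<in>Y. \<exists>D. directed X d D \<and> is_max X d D y"
    using max_continuous Y_X unfolding max_continuous_def by blast
  then obtain D where D: "\<And>y. y \<in> Y \<Longrightarrow> directed X d (D y)"
    and max: "\<And>y. y \<in> Y \<Longrightarrow> is_max X d (D y) y" by metis
  have "is_sup X e (\<Union>y\<in>Y. D y) x \<longleftrightarrow> is_sup X e Y x" for x
    using is_sup_UNION_iff[OF e Y_X directed_subset[OF D] max_imp_sup[OF directed_subset[OF D] max]]
    by blast
  moreover have "directed X d (\<Union>y\<in>Y. D y)"
    using directed_UNION[OF d Y d_e D] max by (simp add: is_max_def)
  moreover have "\<exists>y\<in>Y. d v y = 0" if "v \<in> (\<Union>y\<in>Y. D y)" for v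
    using that max by (auto simp: is_max_def)
  ultimately show ?thesis by blast
qed

lemma sup_complete: "sup_complete X e"
  unfolding sup_complete_def
proof (intro allI impI)
  fix Y assume "directed X e Y"
  then obtain Z where Z: "directed X d Z" "\<And>x. is_sup X e Z x \<longleftrightarrow> is_sup X e Y x"
    using directed_refinement by blast
  from max_complete Z(1) obtain x where "is_max X d Z x" by (auto simp: max_complete_def)
  then have "is_sup X e Z x"
    by (rule max_imp_sup[OF directed_subset[OF Z(1)]])
  with Z(2) show "\<exists>x. is_sup X e Y x" by auto
qed

lemma d_e_sup_continuous: "d_e_sup_continuous X d e"
  using max_continuous max_imp_sup directed_subset
  unfolding max_continuous_def d_e_sup_continuous_def by metis

text \<open>
  A \<open>d\<close>-directed set with maximum \<open>y\<close> is a witness for the lower bound on the way-below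
  distance, since the left action gives \<open>d x y \<le> e x w\<close> for its members \<open>w\<close>. For the upper
  bound, a test set with supremum \<open>z\<close> is refined to a \<open>d\<close>-directed set with maximum \<open>z\<close>,
  which reduces the claim to \<open>d x z \<le> d x y + e y z\<close>.
\<close>

lemma d_eq_way_below:
  assumes x: "x \<in> X" and y: "y \<in> X"
  shows "d x y = way_below X e x y"
proof (rule antisym)
  from max_continuous y obtain D where D: "directed X d D" and max: "is_max X d D y"
    by (auto simp: max_continuous_def)
  note D_X = directed_subset[OF D]
  have "d x y \<le> (INF w\<in>D. e x w)"
  proof (rule INF_greatest)
    fix w assume "w \<in> D"
    then show "d x y \<le> e x w" using e_d[OF x, of w y] D_X max y by (auto simp: is_max_def)
  qed
  also have "\<dots> \<le> e y y + way_below X e x y"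
    using way_below_le_iff[of X e x y "way_below X e x y"] directed_mono[OF D e_le_d]
      max_imp_sup[OF D_X max] by blast
  finally show "d x y \<le> way_below X e x y" by (simp add: e_self y)
next
  show "way_below X e x y \<le> d x y"
    unfolding way_below_le_iff
  proof (intro allI impI)
    fix Y z assume Y: "directed X e Y" and sup: "is_sup X e Y z"
    from Y obtain Z where Z: "directed X d Z" "\<forall>v\<in>Z. \<exists>y\<in>Y. d v y = 0"
      "\<And>x. is_sup X e Z x \<longleftrightarrow> is_sup X e Y x" using directed_refinement by blast
    have z: "z \<in> X" using sup by (simp add: is_sup_def)
    have "(INF w\<in>Y. e x w) \<le> (INF v\<in>Z. d x v)"
    proof (rule INF_greatest)
      fix v assume v: "v \<in> Z"
      with Z(2) obtain w where w: "w \<in> Y" "d v w = 0" by auto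
      have vw: "v \<in> X" "w \<in> X" using v w directed_subset Y Z(1) by blast+
      have "e x w \<le> d x w" using e_le_d x vw by blast
      also have "\<dots> \<le> d x v" using distance_onD[OF d x vw] w(2) by simp
      finally show "(INF w\<in>Y. e x w) \<le> d x v" using w(1) by (rule INF_lower2[rotated])
    qed
    also have "\<dots> \<le> d x z"
      using sup_imp_max[OF Z(1)] Z(3) sup x by (simp add: is_max_def)
    also have "\<dots> \<le> e y z + d x y" using d_e[OF x y z] by (simp add: add.commute)
    finally show "(INF w\<in>Y. e x w) \<le> e y z + d x y" .
  qed
qed

end

section \<open>From suprema to maxima\<close>

locale way_below_distance =
  fixes X :: "'a set" and d e :: "'a \<Rightarrow> 'a \<Rightarrow> ennreal"
  assumes e: "distance_on X e"
    and d_eq: "\<And>x y. x \<in> X \<Longrightarrow> y \<in> X \<Longrightarrow> d x y = way_below X e x y"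
    and sup_complete: "sup_complete X e"
    and sup_continuous: "d_e_sup_continuous X d e"
begin

lemma d_le_iff:
  "x \<in> X \<Longrightarrow> y \<in> X \<Longrightarrow> d x y \<le> c \<longleftrightarrow>
     (\<forall>Z z. directed X e Z \<longrightarrow> is_sup X e Z z \<longrightarrow> (INF w\<in>Z. e x w) \<le> e y z + c)"
  by (simp add: d_eq way_below_le_iff)

lemma INF_le_d:
  assumes "x \<in> X" "y \<in> X" "directed X e Z" "is_sup X e Z z"
  shows "(INF w\<in>Z. e x w) \<le> e y z + d x y"
  using d_le_iff[of x y "d x y"] assms by blast

text \<open>
  Every point \<open>x\<close> is a supremum of some set, and the two halves of that property meet at
  \<open>x\<close>: the bound on \<open>e x z\<close> for \<open>z = x\<close> is a supremum of zeros.
\<close>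

lemma e_self:
  assumes "x \<in> X"
  shows "e x x = 0"
proof -
  from sup_continuous assms obtain Y where "is_sup X e Y x"
    by (auto simp: d_e_sup_continuous_def)
  then have "e x x \<le> (SUP y\<in>Y. e y x)" "\<forall>y\<in>Y. e y x = 0" by (auto simp: is_sup_def)
  then show ?thesis by (metis SUP_bot_conv(2) bot_ennreal le_zero_eq)
qed

text \<open>
  The singleton of \<open>y\<close> is directed with supremum \<open>y\<close>, hence one of the sets on which the
  way-below distance is tested.
\<close>

lemma e_le_d:
  assumes x: "x \<in> X" and y: "y \<in> X"
  shows "e x y \<le> d x y"
proof -
  have "directed X e {y}"
    using y by (auto simp: directed_iff_pairs[OF e] e_self)
  moreover have "is_sup X e {y} y"
    using y by (simp add: is_sup_def e_self)
  ultimately have "(INF w\<in>{y}. e x w) \<le> e y y + d x y" by (rule INF_le_d[OF x y])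
  then show ?thesis by (simp add: e_self y)
qed

lemma d_directed_imp_e_directed: "directed X d Y \<Longrightarrow> directed X e Y"
  using directed_mono e_le_d by blast

lemma d_e:
  assumes "x \<in> X" "y \<in> X" "z \<in> X"
  shows "d x z \<le> d x y + e y z"
  unfolding d_le_iff[OF assms(1,3)]
proof (intro allI impI)
  fix Z s assume Z: "directed X e Z" "is_sup X e Z s"
  then have s: "s \<in> X" by (simp add: is_sup_def)
  have "(INF w\<in>Z. e x w) \<le> e y s + d x y" by (rule INF_le_d[OF assms(1,2) Z])
  also have "\<dots> \<le> (e y z + e z s) + d x y"
    by (intro add_right_mono distance_onD[OF e] assms s)
  finally show "(INF w\<in>Z. e x w) \<le> e z s + (d x y + e y z)" by (simp add: ac_simps)
qed

lemma e_d:
  assumes "x \<in> X" "y \<in> X" "z \<in> X"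
  shows "d x z \<le> e x y + d y z"
  unfolding d_le_iff[OF assms(1,3)]
proof (intro allI impI)
  fix Z s assume Z: "directed X e Z" "is_sup X e Z s"
  have "(INF w\<in>Z. e x w) \<le> e x y + (INF w\<in>Z. e y w)"
  proof (rule le_INF_add)
    fix w assume w: "w \<in> Z"
    then have "w \<in> X" using directed_subset[OF Z(1)] by blast
    then show "(INF w\<in>Z. e x w) \<le> e x y + e y w"
      by (intro INF_lower2[OF w] distance_onD[OF e] assms)
  qed
  also have "\<dots> \<le> e x y + (e z s + d y z)"
    by (intro add_left_mono INF_le_d[OF assms(2,3) Z])
  finally show "(INF w\<in>Z. e x w) \<le> e z s + (e x y + d y z)" by (simp add: ac_simps)
qed

text \<open>
  The supremum property gives only \<open>e v x = 0\<close>. The right action transfers the stronger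
  \<open>d\<close>-bound from the members of \<open>Y\<close>, which come arbitrarily \<open>d\<close>-close above \<open>v\<close>.
\<close>

lemma sup_is_d_upper_bound:
  assumes Y: "directed X d Y" and sup: "is_sup X e Y x" and v: "v \<in> Y"
  shows "d v x = 0"
proof -
  note Y_X = directed_subset[OF Y]
  have "d v x \<le> (INF y\<in>Y. d v y)"
  proof (rule INF_greatest)
    fix y assume "y \<in> Y"
    then show "d v x \<le> d v y"
      using d_e[of v y x] sup v Y_X by (auto simp: is_sup_def)
  qed
  then show ?thesis by (simp add: directed_INF_self[OF Y v])
qed

text \<open>
  The interpolation step. The way-below inequality is applied to the union of \<open>d\<close>-directed
  sets approximating the points of \<open>Y\<close>, not to \<open>Y\<close>: the extra layer is what converts
  \<open>e\<close>-distances to the union into \<open>d\<close>-distances to \<open>Y\<close>.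
\<close>

lemma sup_imp_max:
  assumes Y: "directed X d Y" and sup: "is_sup X e Y x"
  shows "is_max X d Y x"
  unfolding is_max_def
proof (intro conjI ballI)
  note Y_X = directed_subset[OF Y]
  show x: "x \<in> X" using sup by (simp add: is_sup_def)
  show "d y x = 0" if "y \<in> Y" for y by (rule sup_is_d_upper_bound[OF Y sup that])
  fix z assume z: "z \<in> X"
  have "\<forall>y\<in>Y. \<exists>D. directed X d D \<and> is_sup X e D y"
    using sup_continuous Y_X unfolding d_e_sup_continuous_def by blast
  then obtain D where D: "\<And>y. y \<in> Y \<Longrightarrow> directed X d (D y)"
    and D_sup: "\<And>y. y \<in> Y \<Longrightarrow> is_sup X e (D y) y" by metis
  have D_X: "D y \<subseteq> X" if "y \<in> Y" for y by (rule directed_subset[OF D[OF that]])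
  have approx: "(INF w\<in>D y. e u w) \<le> d u y" if "y \<in> Y" "u \<in> X" for y u
    using INF_le_d[of u y "D y" y] d_directed_imp_e_directed[OF D] D_sup e_self that Y_X by auto
  have "directed X e (\<Union>y\<in>Y. D y)"
    using directed_UNION[OF e d_directed_imp_e_directed[OF Y] d_e d_directed_imp_e_directed[OF D]
        sup_is_d_upper_bound[OF D D_sup] approx] by blast
  moreover have "is_sup X e (\<Union>y\<in>Y. D y) x"
    using is_sup_UNION_iff[OF e Y_X D_X D_sup] sup by blast
  ultimately have "(INF v\<in>(\<Union>y\<in>Y. D y). e z v) \<le> e x x + d z x"
    by (rule INF_le_d[OF z x])
  then have "(INF v\<in>(\<Union>y\<in>Y. D y). e z v) \<le> d z x" by (simp add: e_self x)
  moreover have "(INF w\<in>Y. d z w) \<le> (INF v\<in>(\<Union>y\<in>Y. D y). e z v)"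
  proof (rule INF_greatest)
    fix v assume "v \<in> (\<Union>y\<in>Y. D y)"
    then obtain y where y: "y \<in> Y" "v \<in> D y" by auto
    have "d z y \<le> e z v + d v y" using e_d z y D_X Y_X by blast
    also have "d v y = 0" by (rule sup_is_d_upper_bound[OF D[OF y(1)] D_sup[OF y(1)] y(2)])
    finally show "(INF w\<in>Y. d z w) \<le> e z v" using y(1) by (auto intro: INF_lower2)
  qed
  ultimately show "(INF w\<in>Y. d z w) \<le> d z x" by (rule order_trans[rotated])
qed

lemma max_complete: "max_complete X d"
  using sup_complete d_directed_imp_e_directed sup_imp_max
  unfolding max_complete_def sup_complete_def by blast

lemma max_continuous: "max_continuous X d"
  using sup_continuous sup_imp_max unfolding max_continuous_def d_e_sup_continuous_def by blast

lemma upper_hemi_le: "x \<in> X \<Longrightarrow> y \<in> X \<Longrightarrow> upper_hemi X d x y \<le> e x y"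
  using e_d by (simp add: upper_hemi_le_iff add.commute)

text \<open>
  One inequality is the right action. For the other, \<open>x\<close> is the supremum of a \<open>d\<close>-directed
  set whose members \<open>v\<close> satisfy \<open>d v x = 0\<close>, so that each \<open>e v y \<le> d v y\<close> is at most the
  term of the lower hemimetric that is indexed by \<open>v\<close>.
\<close>

lemma e_eq_lower_hemi:
  assumes x: "x \<in> X" and y: "y \<in> X"
  shows "e x y = lower_hemi X d x y"
proof (rule antisym)
  show "lower_hemi X d x y \<le> e x y" using d_e x y by (simp add: lower_hemi_le_iff)
  from sup_continuous x obtain D where D: "directed X d D" and sup: "is_sup X e D x"
    by (auto simp: d_e_sup_continuous_def)
  have "e x y \<le> (SUP v\<in>D. e v y)" using sup y by (simp add: is_sup_def)
  also have "\<dots> \<le> lower_hemi X d x y"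
  proof (rule SUP_least)
    fix v assume v: "v \<in> D"
    then have vX: "v \<in> X" using directed_subset[OF D] by blast
    have "e v y \<le> d v y" by (rule e_le_d[OF vX y])
    also have "\<dots> \<le> d v x + lower_hemi X d x y"
      using lower_hemi_le_iff[of X d x y "lower_hemi X d x y"] vX by simp
    also have "d v x = 0" by (rule sup_is_d_upper_bound[OF D sup v])
    finally show "e v y \<le> lower_hemi X d x y" by simp
  qed
  finally show "e x y \<le> lower_hemi X d x y" .
qed

end

section \<open>The equivalence\<close>

theorem theorem3p7:
  fixes X :: "'a set" and d e :: "'a \<Rightarrow> 'a \<Rightarrow> ennreal"
  assumes "distance_on X d" and "distance_on X e"
  shows "(sup_complete X e \<and> d_e_sup_continuous X d e \<and>
            (\<forall>x\<in>X. \<forall>y\<in>X. d x y = way_below X e x y))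
     \<longleftrightarrow> (max_complete X d \<and> max_continuous X d \<and>
            (\<forall>x\<in>X. \<forall>y\<in>X. e x y = lower_hemi X d x y) \<and>
            (\<forall>x\<in>X. \<forall>y\<in>X. upper_hemi X d x y \<le> lower_hemi X d x y))"
    (is "?sup \<longleftrightarrow> ?max")
proof
  assume ?sup
  then interpret way_below_distance X d e
    using assms(2) by unfold_locales auto
  show ?max
    using max_complete max_continuous e_eq_lower_hemi upper_hemi_le by auto
next
  assume ?max
  then interpret lower_hemimetric_distance X d e
    using assms by unfold_locales auto
  show ?sup
    using sup_complete d_e_sup_continuous d_eq_way_below by auto
qed

end
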